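(* Let $n\ge 6$. The acyclic polynomial $A(J_n,x)$ of the graph $J_n$ has a real root $r$ with \[ -\frac{n^2}{2}-\frac{5n}{2}+17\ \le\ r\ \le\ -\frac{n^2}{2}-\frac{5n}{2}+18, \] and $A(J_n,x)$ has no root of modulus larger than $\frac{n^2}{2}+\frac{5n}{2}-17$.
   Context: Graphs are finite, undirected and simple. The acyclic polynomial of a graph $G$ is $A(G,x)=\sum_{i\ge 0} a_i x^i$, where $a_i=|\{S\subseteq V(G): |S|=i \text{ and } G[S] \text{ is acyclic}\}|$ and $G[S]$ is the subgraph of $G$ induced by $S$ (acyclic means containing no cycle; the empty set is acyclic). For $n\ge5$, $J_n=\overline{S_{n-4}\cup C_4}$ is the complement of the disjoint union of the star $S_{n-4}$ on $n-4$ vertices (i.e. $K_{1,n-5}$) and the cycle $C_4$ on $4$ vertices; thus $J_n$ has order $n$. *)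

theory Defs
  imports Complex_Main "HOL-Computational_Algebra.Polynomial"
begin

record 'a ugraph =
  verts :: "'a set"
  edges :: "'a set set"

definition simple_graph :: "'a ugraph \<Rightarrow> bool" where
  "simple_graph G \<longleftrightarrow>
     finite (verts G) \<and> (\<forall>e\<in>edges G. e \<subseteq> verts G \<and> card e = 2)"

definition complement :: "'a ugraph \<Rightarrow> 'a ugraph" where
  "complement G =
     \<lparr>verts = verts G, edges = {e. e \<subseteq> verts G \<and> card e = 2} - edges G\<rparr>"

definition disjoint_union :: "'a ugraph \<Rightarrow> 'b ugraph \<Rightarrow> ('a + 'b) ugraph" where
  "disjoint_union G H =
     \<lparr>verts = verts G <+> verts H,
      edges = (\<lambda>e. Inl ` e) ` edges G \<union> (\<lambda>e. Inr ` e) ` edges H\<rparr>"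

definition induced_subgraph :: "'a ugraph \<Rightarrow> 'a set \<Rightarrow> 'a ugraph" where
  "induced_subgraph G S = \<lparr>verts = S, edges = {e \<in> edges G. e \<subseteq> S}\<rparr>"

text \<open>A cycle is given by its cyclic sequence of distinct vertices; the length bound
  excludes traversing a single edge back and forth.\<close>

definition is_cycle :: "'a ugraph \<Rightarrow> 'a list \<Rightarrow> bool" where
  "is_cycle G vs \<longleftrightarrow>
     length vs \<ge> 3 \<and> distinct vs \<and> set vs \<subseteq> verts G \<and>
     (\<forall>i<length vs. {vs ! i, vs ! (Suc i mod length vs)} \<in> edges G)"

definition acyclic_graph :: "'a ugraph \<Rightarrow> bool" where
  "acyclic_graph G \<longleftrightarrow> \<not> (\<exists>vs. is_cycle G vs)"

text \<open>The star on \<open>m\<close> vertices in total, i.e. \<open>K\<^bsub>1,m-1\<^esub>\<close>, with centre \<open>0\<close>.\<close>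

definition star_graph :: "nat \<Rightarrow> nat ugraph" where
  "star_graph m = \<lparr>verts = {..<m}, edges = {{0, i} |i. 0 < i \<and> i < m}\<rparr>"

text \<open>Only meant for \<open>m \<ge> 3\<close>.\<close>

definition cycle_graph :: "nat \<Rightarrow> nat ugraph" where
  "cycle_graph m = \<lparr>verts = {..<m}, edges = {{i, Suc i mod m} |i. i < m}\<rparr>"

definition acyclic_count :: "'a ugraph \<Rightarrow> nat \<Rightarrow> nat" where
  "acyclic_count G i =
     card {S. S \<subseteq> verts G \<and> card S = i \<and> acyclic_graph (induced_subgraph G S)}"

text \<open>The sum may stop at the order of the graph, since the counts vanish beyond it.\<close>

definition acyclic_poly :: "'a ugraph \<Rightarrow> real poly" where
  "acyclic_poly G = (\<Sum>i\<le>card (verts G). monom (of_nat (acyclic_count G i)) i)"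

text \<open>Only meant for \<open>n \<ge> 5\<close>, because of the truncated subtraction.\<close>

definition J_graph :: "nat \<Rightarrow> (nat + nat) ugraph" where
  "J_graph n = complement (disjoint_union (star_graph (n - 4)) (cycle_graph 4))"

lemma simple_graph_complement:
  "finite (verts G) \<Longrightarrow> simple_graph (complement G)"
  by (auto simp: simple_graph_def complement_def)

lemma simple_graph_star_graph: "simple_graph (star_graph m)"
  by (auto simp: simple_graph_def star_graph_def)

lemma simple_graph_cycle_graph:
  assumes "m \<ge> 3"
  shows "simple_graph (cycle_graph m)"
proof -
  have "i \<noteq> Suc i mod m" if "i < m" for i
    using that assms by (auto simp: mod_Suc)
  with assms show ?thesis
    by (fastforce simp: simple_graph_def cycle_graph_def)
qed

lemma simple_graph_J_graph: "simple_graph (J_graph n)"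
  unfolding J_graph_def
  by (rule simple_graph_complement)
    (simp add: disjoint_union_def star_graph_def cycle_graph_def)

lemma order_J_graph: "n \<ge> 5 \<Longrightarrow> card (verts (J_graph n)) = n"
  by (simp add: J_graph_def complement_def disjoint_union_def star_graph_def
      cycle_graph_def card_Plus)

lemma acyclic_graph_empty: "acyclic_graph (induced_subgraph G {})"
  by (auto simp: acyclic_graph_def is_cycle_def induced_subgraph_def)

lemma acyclic_count_eq_0:
  assumes "finite (verts G)" "i > card (verts G)"
  shows "acyclic_count G i = 0"
proof -
  have "{S. S \<subseteq> verts G \<and> card S = i \<and> acyclic_graph (induced_subgraph G S)} = {}"
    using assms card_mono by (auto simp flip: not_le)
  then show ?thesis
    by (simp only: acyclic_count_def card.empty)
qed

lemma coeff_acyclic_poly: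
  assumes "finite (verts G)"
  shows "coeff (acyclic_poly G) i = real (acyclic_count G i)"
  using acyclic_count_eq_0[OF assms, of i]
  by (auto simp: acyclic_poly_def coeff_sum not_le)

end

theory Submission
  imports Defs
begin

text \<open>
  The graph is the join of an isolated vertex together with a clique (the complement of the star)
  and of two disjoint edges (the complement of \<open>C\<^sub>4\<close>). It has so few large acyclic sets that the
  polynomial is only quartic, namely
  \<open>A(x) = 1 + n x + b x\<^sup>2 + a x\<^sup>3 + x\<^sup>4\<close> with \<open>b = n (n - 1) / 2\<close> and
  \<open>a = n\<^sup>2/2 + 5n/2 - 17\<close> (\<open>acyclic_poly_J_graph\<close>). The coefficients up to degree two are those of
  any simple graph of order \<open>n\<close>. Three vertices induce an acyclic subgraph exactly if some two of
  them are adjacent in \<open>S\<^bsub>n-4\<^esub> \<union> C\<^sub>4\<close> (\<open>acyclic_complement_triple_iff\<close>), and counting these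
  triples by how many of their vertices lie in the star gives \<open>a\<close>. With four or more vertices,
  only the vertex set of \<open>C\<^sub>4\<close> survives (\<open>acyclic_J_graph_card_ge_4\<close>): a set that meets
  both parts of the join in two vertices contains a 4-cycle, and the other ones contain a triangle.

  The number \<open>-a\<close> is almost a root, since the two leading terms cancel there. What remains is
  \<open>A(-a) = b a\<^sup>2 - n a + 1 > 0\<close>, whereas at \<open>1 - a\<close> the leading terms contribute \<open>-(a - 1)\<^sup>3\<close>,
  and this outweighs the quadratic term as soon as \<open>b + 1 \<le> a\<close>, that is, \<open>18 \<le> 3 n\<close>. So the
  intermediate value theorem gives the root. That no root is larger in modulus than \<open>a\<close> is the
  bound of Enestroem and Kakeya: \<open>a\<close> is the largest quotient of consecutive coefficients
  (\<open>quartic_root_bound\<close>).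
\<close>

section \<open>Cycles in small graphs\<close>

lemma acyclic_induced_iff:
  assumes "S \<subseteq> verts G"
  shows "acyclic_graph (induced_subgraph G S) \<longleftrightarrow> \<not> (\<exists>vs. is_cycle G vs \<and> set vs \<subseteq> S)"
proof -
  have "is_cycle (induced_subgraph G S) vs \<longleftrightarrow> is_cycle G vs \<and> set vs \<subseteq> S" for vs
  proof
    assume "is_cycle (induced_subgraph G S) vs"
    then show "is_cycle G vs \<and> set vs \<subseteq> S"
      using assms by (auto simp: is_cycle_def induced_subgraph_def)
  next
    assume c: "is_cycle G vs \<and> set vs \<subseteq> S"
    have "{vs ! i, vs ! (Suc i mod length vs)} \<subseteq> S" if "i < length vs" for i
    proof -
      have "Suc i mod length vs < length vs" using that by (intro mod_less_divisor) auto
      with that c show ?thesis by (auto dest: nth_mem)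
    qed
    with c show "is_cycle (induced_subgraph G S) vs"
      by (auto simp: is_cycle_def induced_subgraph_def)
  qed
  then show ?thesis by (simp add: acyclic_graph_def)
qed

text \<open>
  The predecessor and the successor on the cycle differ because it has at least three vertices.
  Acyclicity of a set of three or more vertices is shown below by contradicting this.
\<close>

lemma cycle_two_neighbours:
  assumes "is_cycle G vs" "v \<in> set vs"
  obtains u w where "u \<noteq> w" "u \<in> set vs" "w \<in> set vs" "{v, u} \<in> edges G" "{v, w} \<in> edges G"
proof -
  define l where "l = length vs"
  have l: "l \<ge> 3" "distinct vs"
    and e: "\<And>i. i < l \<Longrightarrow> {vs ! i, vs ! (Suc i mod l)} \<in> edges G"
    using assms(1) by (auto simp: is_cycle_def l_def)
  obtain i where i: "i < l" "v = vs ! i"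
    using assms(2) by (auto simp: in_set_conv_nth l_def)
  define s where "s = Suc i mod l"
  define p where "p = (if i = 0 then l - 1 else i - 1)"
  have sp: "s < l" "p < l" "s \<noteq> p" "Suc p mod l = i"
    using l(1) i(1) by (auto simp: s_def p_def mod_Suc)
  show thesis
  proof (rule that)
    show "vs ! s \<noteq> vs ! p" using sp l by (simp add: nth_eq_iff_index_eq l_def)
    show "vs ! s \<in> set vs" "vs ! p \<in> set vs" using sp by (auto simp: l_def)
    show "{v, vs ! s} \<in> edges G" using e[OF i(1)] i by (simp add: s_def)
    show "{v, vs ! p} \<in> edges G" using e[OF sp(2)] sp(4) i by (simp add: insert_commute)
  qed
qed

lemma acyclic_induced_card_le_2:
  assumes "S \<subseteq> verts G" "finite S" "card S \<le> 2"
  shows "acyclic_graph (induced_subgraph G S)"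
proof -
  have "\<not> (is_cycle G vs \<and> set vs \<subseteq> S)" for vs
  proof
    assume c: "is_cycle G vs \<and> set vs \<subseteq> S"
    then have "card (set vs) \<ge> 3" by (auto simp: is_cycle_def distinct_card)
    moreover have "card (set vs) \<le> card S" using c assms by (intro card_mono) auto
    ultimately show False using assms by simp
  qed
  then show ?thesis using assms by (auto simp: acyclic_induced_iff)
qed

lemma triangle_not_acyclic:
  assumes "S \<subseteq> verts G" "x \<in> S" "y \<in> S" "z \<in> S" "distinct [x, y, z]"
    and "{x, y} \<in> edges G" "{y, z} \<in> edges G" "{x, z} \<in> edges G"
  shows "\<not> acyclic_graph (induced_subgraph G S)"
proof -
  have "{z, x} \<in> edges G" using assms(8) by (simp only: insert_commute)
  then have "is_cycle G [x, y, z]"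
    using assms by (auto simp: is_cycle_def All_less_Suc)
  then show ?thesis using assms by (auto simp: acyclic_induced_iff intro!: exI[of _ "[x, y, z]"])
qed

lemma four_cycle_not_acyclic:
  assumes "S \<subseteq> verts G" "{w, x, y, z} \<subseteq> S" "distinct [w, x, y, z]"
    and "{w, x} \<in> edges G" "{x, y} \<in> edges G" "{y, z} \<in> edges G" "{z, w} \<in> edges G"
  shows "\<not> acyclic_graph (induced_subgraph G S)"
proof -
  have "is_cycle G [w, x, y, z]"
    using assms by (auto simp: is_cycle_def All_less_Suc)
  then show ?thesis using assms by (auto simp: acyclic_induced_iff intro!: exI[of _ "[w, x, y, z]"])
qed

text \<open>
  A cycle on three vertices is a triangle, and a triangle of the complement is a triple that is
  independent in the graph itself.
\<close>

lemma acyclic_complement_triple_iff: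
  assumes "simple_graph G" "S \<subseteq> verts G" "card S = 3"
  shows "acyclic_graph (induced_subgraph (complement G) S) \<longleftrightarrow> (\<exists>e\<in>edges G. e \<subseteq> S)"
proof
  assume ac: "acyclic_graph (induced_subgraph (complement G) S)"
  obtain x y z where S: "S = {x, y, z}" "distinct [x, y, z]"
    using assms(3) by (auto simp: card_3_iff)
  show "\<exists>e\<in>edges G. e \<subseteq> S"
  proof (rule ccontr)
    assume none: "\<not> ?thesis"
    have edge: "{a, b} \<in> edges (complement G)" if "a \<in> S" "b \<in> S" "a \<noteq> b" for a b
    proof -
      have "{a, b} \<subseteq> S" using that by simp
      then have "{a, b} \<notin> edges G" "{a, b} \<subseteq> verts G" using none assms(2) by blast+
      then show ?thesis using that(3) by (simp add: complement_def)
    qed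
    have "\<not> acyclic_graph (induced_subgraph (complement G) S)"
    proof (rule triangle_not_acyclic[of _ _ x y z])
      show "S \<subseteq> verts (complement G)" using assms(2) by (simp add: complement_def)
    qed (use S edge in simp_all)
    with ac show False by simp
  qed
next
  assume "\<exists>e\<in>edges G. e \<subseteq> S"
  then obtain e where e: "e \<in> edges G" "e \<subseteq> S" by blast
  then have "card e = 2" using assms(1) by (auto simp: simple_graph_def)
  then obtain x y where xy: "e = {x, y}" "x \<noteq> y" by (auto simp: card_2_iff)
  have fin: "finite S" using assms(3) card.infinite by fastforce
  have "\<not> (is_cycle (complement G) vs \<and> set vs \<subseteq> S)" for vs
  proof
    assume c: "is_cycle (complement G) vs \<and> set vs \<subseteq> S"
    have "card (set vs) \<ge> 3" using c by (auto simp: is_cycle_def distinct_card)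
    then have vs: "set vs = S" using c assms(3) fin by (metis card_seteq)
    then have "x \<in> set vs" using e xy by auto
    then obtain u w where uw: "u \<noteq> w" "u \<in> S" "w \<in> S" "{x, u} \<in> edges (complement G)"
        "{x, w} \<in> edges (complement G)"
      using c vs by (metis cycle_two_neighbours)
    have "u \<noteq> x" "w \<noteq> x" using uw by (auto simp: complement_def)
    \<comment> \<open>Only two vertices of \<open>S\<close> differ from \<open>x\<close>, so both are neighbours of \<open>x\<close>, \<open>y\<close> among them.\<close>
    then have "{x, u, w} = S" using uw e xy assms(3) fin by (intro card_seteq) auto
    then have "y = u \<or> y = w" using e xy by auto
    then have "e \<in> edges (complement G)" using uw xy by auto
    then show False using e by (auto simp: complement_def)
  qed
  then show "acyclic_graph (induced_subgraph (complement G) S)"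
    using assms(2) by (subst acyclic_induced_iff) (auto simp: complement_def)
qed

lemma acyclic_count_le_2:
  assumes "finite (verts G)" "i \<le> 2"
  shows "acyclic_count G i = card (verts G) choose i"
proof -
  have "{S. S \<subseteq> verts G \<and> card S = i \<and> acyclic_graph (induced_subgraph G S)} =
        {S. S \<subseteq> verts G \<and> card S = i}"
    using assms by (auto intro: acyclic_induced_card_le_2 finite_subset)
  then show ?thesis using assms by (simp add: acyclic_count_def n_subsets)
qed

section \<open>The acyclic vertex sets of the graph\<close>

lemma simple_graph_disjoint_union:
  assumes "simple_graph G" "simple_graph H"
  shows "simple_graph (disjoint_union G H)"
  using assms by (auto simp: simple_graph_def disjoint_union_def card_image)

lemma verts_J_graph: "verts (J_graph n) = {..<n - 4} <+> {..<4}"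
  by (simp add: J_graph_def complement_def disjoint_union_def star_graph_def cycle_graph_def)

lemma edges_cycle_graph_4: "edges (cycle_graph 4) = {{0, 1}, {1, 2}, {2, 3}, {0, 3}}"
proof -
  have "edges (cycle_graph 4) = (\<lambda>i. {i, Suc i mod 4}) ` {..<4}"
    by (auto simp: cycle_graph_def)
  also have "{..<4::nat} = {0, 1, 2, 3}" by auto
  also have "(\<lambda>i. {i, Suc i mod 4}) ` {0, 1, 2, 3} = {{0, 1}, {1, 2}, {2, 3}, {3, 0 :: nat}}"
  proof -
    have "Suc 0 mod 4 = 1" "Suc 1 mod 4 = 2" "Suc 2 mod 4 = 3" "Suc 3 mod 4 = 0" by simp_all
    then show ?thesis by (simp only: image_insert image_empty)
  qed
  also have "{3, 0 :: nat} = {0, 3}" by (rule insert_commute)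
  finally show ?thesis .
qed

lemma edges_star_graph: "edges (star_graph m) = (\<lambda>i. {0, i}) ` {1..<m}"
  by (auto simp: star_graph_def)

lemma sum_set_eq_Plus: "S = (Inl -` S) <+> (Inr -` S)"
proof (rule set_eqI)
  fix s show "s \<in> S \<longleftrightarrow> s \<in> (Inl -` S) <+> (Inr -` S)" by (cases s) auto
qed

lemma edges_disjoint_union_iff:
  assumes "e \<noteq> {}"
  shows "Inl ` e \<in> edges (disjoint_union G H) \<longleftrightarrow> e \<in> edges G"
    and "Inr ` e \<in> edges (disjoint_union G H) \<longleftrightarrow> e \<in> edges H"
proof -
  have ne: "Inl ` e \<noteq> Inr ` f" "Inr ` e \<noteq> Inl ` f" for f using assms by auto
  show "Inl ` e \<in> edges (disjoint_union G H) \<longleftrightarrow> e \<in> edges G"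
    using ne(1) by (auto simp: disjoint_union_def inj_image_eq_iff image_iff)
  show "Inr ` e \<in> edges (disjoint_union G H) \<longleftrightarrow> e \<in> edges H"
    using ne(2) by (auto simp: disjoint_union_def inj_image_eq_iff image_iff)
qed

lemma J_graph_edge_iff:
  assumes "u \<in> verts (J_graph n)" "v \<in> verts (J_graph n)"
  shows "{u, v} \<in> edges (J_graph n) \<longleftrightarrow>
    u \<noteq> v \<and> {u, v} \<notin> edges (disjoint_union (star_graph (n - 4)) (cycle_graph 4))"
  using assms by (auto simp: J_graph_def complement_def)

lemma J_graph_edge_leaves:
  assumes "i \<noteq> j" "0 < i" "0 < j" "i < n - 4" "j < n - 4"
  shows "{Inl i, Inl j} \<in> edges (J_graph n)"
proof -
  have "{i, j} \<notin> edges (star_graph (n - 4))"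
    using assms by (auto simp: star_graph_def doubleton_eq_iff)
  then show ?thesis
    using assms edges_disjoint_union_iff(1)[of "{i, j}"]
    by (simp add: J_graph_edge_iff verts_J_graph InlI)
qed

lemma J_graph_edge_join:
  assumes "i < n - 4" "j < 4"
  shows "{Inl i, Inr j} \<in> edges (J_graph n)"
proof -
  have "{Inl i, Inr j} \<noteq> Inl ` e" "{Inl i, Inr j} \<noteq> Inr ` e'" for e e' :: "nat set" by auto
  then have "{Inl i, Inr j} \<notin> edges (disjoint_union (star_graph (n - 4)) (cycle_graph 4))"
    unfolding disjoint_union_def by (metis UnE image_iff ugraph.select_convs(2))
  then show ?thesis using assms by (simp add: J_graph_edge_iff verts_J_graph InlI InrI)
qed

lemma J_graph_edge_cycle_iff:
  assumes "i < 4" "j < 4"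
  shows "{Inr i, Inr j} \<in> edges (J_graph n) \<longleftrightarrow> i \<noteq> j \<and> {i, j} \<notin> edges (cycle_graph 4)"
  using assms edges_disjoint_union_iff(2)[of "{i, j}"]
  by (simp add: J_graph_edge_iff verts_J_graph InrI)

lemma cycle_4_triple_has_chord:
  assumes "Y \<subseteq> {..<4::nat}" "card Y \<ge> 3"
  obtains i j where "i \<in> Y" "j \<in> Y" "i \<noteq> j" "{i, j} \<notin> edges (cycle_graph 4)"
proof -
  have "{0, 2} \<subseteq> Y \<or> {1, 3} \<subseteq> Y"
  proof (rule ccontr)
    assume "\<not> ?thesis"
    then obtain a b where "a \<notin> Y" "b \<notin> Y" "a \<in> {0, 2}" "b \<in> {1, 3}" by auto
    then have "Y \<subseteq> {..<4} - {a, b}" "card ({..<4} - {a, b}) = 2"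
      using assms(1) by (auto simp: card_Diff_subset)
    then have "card Y \<le> 2" by (metis card_mono finite_Diff finite_lessThan)
    then show False using assms(2) by simp
  qed
  then show thesis
    using that[of 0 2] that[of 1 3] by (auto simp: edges_cycle_graph_4 doubleton_eq_iff)
qed

lemma two_elements:
  assumes "card A \<ge> 2"
  obtains x y where "x \<in> A" "y \<in> A" "x \<noteq> y"
proof -
  obtain B where "B \<subseteq> A" "card B = 2" by (rule obtain_subset_with_card_n[OF assms])
  then show thesis using that by (auto simp: card_2_iff)
qed

text \<open>
  Let \<open>S\<close> have \<open>X\<close> in the star and \<open>Y\<close> in \<open>C\<^sub>4\<close>. Two vertices in each of \<open>X\<close> and \<open>Y\<close> form a
  4-cycle of the join. Otherwise one of them has at most one vertex. If it is \<open>Y\<close>, then \<open>X\<close> has two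
  leaves forming a triangle with the vertex of \<open>Y\<close>, or three leaves if \<open>Y\<close> is empty. If it is
  \<open>X\<close> and \<open>X\<close> is a single vertex, then this vertex forms a triangle with a diagonal of
  \<open>C\<^sub>4\<close> inside \<open>Y\<close>. What is left is an empty \<open>X\<close>.
\<close>

lemma acyclic_J_graph_card_ge_4:
  assumes S: "S \<subseteq> verts (J_graph n)" and ac: "acyclic_graph (induced_subgraph (J_graph n) S)"
    and "card S \<ge> 4"
  shows "S = {} <+> {..<4}"
proof -
  define X Y where "X = Inl -` S" and "Y = Inr -` S"
  have SXY: "S = X <+> Y" unfolding X_def Y_def by (rule sum_set_eq_Plus)
  have XY: "X \<subseteq> {..<n - 4}" "Y \<subseteq> {..<4}" using S unfolding verts_J_graph SXY by auto
  have fin: "finite X" "finite Y" using XY finite_subset by auto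
  have cXY: "card X + card Y \<ge> 4" using assms(3) fin by (simp add: SXY card_Plus)
  have no_four: "\<not> (card X \<ge> 2 \<and> card Y \<ge> 2)"
  proof
    assume c: "card X \<ge> 2 \<and> card Y \<ge> 2"
    obtain x x' where x: "x \<in> X" "x' \<in> X" "x \<noteq> x'" using c two_elements by metis
    obtain y y' where y: "y \<in> Y" "y' \<in> Y" "y \<noteq> y'" using c two_elements by metis
    have "{Inl a, Inr b} \<in> edges (J_graph n)" "{Inr b, Inl a} \<in> edges (J_graph n)"
      if "a \<in> X" "b \<in> Y" for a b
      using J_graph_edge_join[of a n b] that XY by (auto simp: insert_commute)
    then have "\<not> acyclic_graph (induced_subgraph (J_graph n) S)"
      using S x y by (intro four_cycle_not_acyclic[of _ _ "Inl x" "Inr y" "Inl x'" "Inr y'"])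
        (auto simp: SXY)
    with ac show False by simp
  qed
  have leaves: "card (X - {0}) + card Y \<le> 2" if X2: "card X \<ge> 2"
  proof (rule ccontr)
    assume "\<not> ?thesis"
    then consider "card (X - {0}) \<ge> 3" | "card (X - {0}) \<ge> 2" "card Y \<ge> 1"
      using no_four X2 by linarith
    then show False
    proof cases
      case 1
      obtain B where B: "B \<subseteq> X - {0}" "card B = 3"
        by (rule obtain_subset_with_card_n[OF 1])
      then obtain x y z where xyz: "B = {x, y, z}" "distinct [x, y, z]"
        by (auto simp: card_3_iff)
      have "\<not> acyclic_graph (induced_subgraph (J_graph n) S)"
        using S B XY xyz by (intro triangle_not_acyclic[of _ _ "Inl x" "Inl y" "Inl z"])
          (auto simp: SXY intro!: J_graph_edge_leaves)
      with ac show False by simp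
    next
      case 2
      obtain x y where xy: "x \<in> X - {0}" "y \<in> X - {0}" "x \<noteq> y" using 2 two_elements by metis
      obtain z where z: "z \<in> Y" using 2 by fastforce
      have "\<not> acyclic_graph (induced_subgraph (J_graph n) S)"
        using S xy z XY by (intro triangle_not_acyclic[of _ _ "Inl x" "Inl y" "Inr z"])
          (auto simp: SXY intro!: J_graph_edge_leaves J_graph_edge_join)
      with ac show False by simp
    qed
  qed
  have "card X < 2"
  proof (rule ccontr)
    assume "\<not> card X < 2"
    then have "card (X - {0}) + card Y \<le> 2" using leaves by simp
    moreover have "card X \<le> card (X - {0}) + 1"
      using fin by (cases "0 \<in> X") (simp_all add: card_Diff_singleton)
    ultimately show False using cXY by linarith
  qed
  moreover have "card X \<noteq> 1"
  proof
    assume "card X = 1"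
    then obtain x where x: "X = {x}" by (auto simp: card_1_singleton_iff)
    have "card Y \<ge> 3" using cXY \<open>card X = 1\<close> by simp
    then obtain i j where ij: "i \<in> Y" "j \<in> Y" "i \<noteq> j" "{i, j} \<notin> edges (cycle_graph 4)"
      using cycle_4_triple_has_chord XY(2) by metis
    then have "i < 4" "j < 4" using XY by auto
    then have "\<not> acyclic_graph (induced_subgraph (J_graph n) S)"
      using S x ij XY by (intro triangle_not_acyclic[of _ _ "Inl x" "Inr i" "Inr j"])
        (auto simp: SXY J_graph_edge_cycle_iff intro!: J_graph_edge_join)
    with ac show False by simp
  qed
  ultimately have "card X = 0" by linarith
  then have "X = {}" "card Y \<ge> 4" using fin cXY by auto
  then have "Y = {..<4}" using XY by (intro card_seteq) auto
  with \<open>X = {}\<close> show ?thesis by (simp add: SXY)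
qed

text \<open>
  The two diagonals of \<open>C\<^sub>4\<close> form a perfect matching, so no vertex has two neighbours.
\<close>

lemma acyclic_J_graph_cycle_part:
  "acyclic_graph (induced_subgraph (J_graph n) ({} <+> {..<4}))"
proof -
  have "\<not> (is_cycle (J_graph n) vs \<and> set vs \<subseteq> {} <+> {..<4})" for vs
  proof
    assume c: "is_cycle (J_graph n) vs \<and> set vs \<subseteq> {} <+> {..<4}"
    then have "vs \<noteq> []" by (auto simp: is_cycle_def)
    then have "hd vs \<in> set vs" by simp
    then obtain u w where uw: "u \<noteq> w" "u \<in> set vs" "w \<in> set vs"
        "{hd vs, u} \<in> edges (J_graph n)" "{hd vs, w} \<in> edges (J_graph n)"
      using c by (metis cycle_two_neighbours)
    have "hd vs \<in> Inr ` {..<4}" "u \<in> Inr ` {..<4}" "w \<in> Inr ` {..<4}"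
      using c uw \<open>hd vs \<in> set vs\<close> by auto
    then obtain h i j where hij: "hd vs = Inr h" "u = Inr i" "w = Inr j" "h < 4" "i < 4" "j < 4"
      by auto
    then have ne: "h \<noteq> i" "h \<noteq> j" "i \<noteq> j" "{h, i} \<notin> edges (cycle_graph 4)"
        "{h, j} \<notin> edges (cycle_graph 4)"
      using uw J_graph_edge_cycle_iff by auto
    have "h \<in> {0, 1, 2, 3}" "i \<in> {0, 1, 2, 3}" "j \<in> {0, 1, 2, 3}"
      using hij by auto
    then show False using ne by (auto simp: edges_cycle_graph_4 doubleton_eq_iff)
  qed
  then show ?thesis by (subst acyclic_induced_iff) (auto simp: verts_J_graph)
qed

lemma acyclic_count_J_graph_4: "acyclic_count (J_graph n) 4 = 1"
proof -
  have "{S. S \<subseteq> verts (J_graph n) \<and> card S = 4 \<and> acyclic_graph (induced_subgraph (J_graph n) S)}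
    = {{} <+> {..<4}}"
  proof (intro equalityI subsetI)
    fix S :: "(nat + nat) set" assume "S \<in> {{} <+> {..<4}}"
    then show "S \<in> {S. S \<subseteq> verts (J_graph n) \<and> card S = 4 \<and>
        acyclic_graph (induced_subgraph (J_graph n) S)}"
      using acyclic_J_graph_cycle_part[of n] by (auto simp: verts_J_graph card_Plus)
  next
    fix S assume S: "S \<in> {S. S \<subseteq> verts (J_graph n) \<and> card S = 4 \<and>
        acyclic_graph (induced_subgraph (J_graph n) S)}"
    then have "S = {} <+> {..<4}" by (intro acyclic_J_graph_card_ge_4[of _ n]) auto
    then show "S \<in> {{} <+> {..<4}}" by simp
  qed
  then show ?thesis by (simp add: acyclic_count_def)
qed

lemma acyclic_count_J_graph_ge_5:
  assumes "i \<ge> 5"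
  shows "acyclic_count (J_graph n) i = 0"
proof -
  have "{S. S \<subseteq> verts (J_graph n) \<and> card S = i \<and> acyclic_graph (induced_subgraph (J_graph n) S)}
    = {}"
  proof (intro equals0I)
    fix S assume S: "S \<in> {S. S \<subseteq> verts (J_graph n) \<and> card S = i \<and>
        acyclic_graph (induced_subgraph (J_graph n) S)}"
    then have "S = {} <+> {..<4}" using assms by (intro acyclic_J_graph_card_ge_4[of _ n]) auto
    then show False using S assms by (simp add: card_Plus)
  qed
  then show ?thesis by (simp only: acyclic_count_def card.empty)
qed

text \<open>
  The acyclic triples \<open>X <+> Y\<close> of the graph, listed by the size 3, 2, 1, 0 of \<open>X\<close>, where \<open>m\<close> is the
  order of the star. The edge of \<open>S\<^sub>m \<union> C\<^sub>4\<close> that the triple must contain lies in the star in the first two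
  lines and in \<open>C\<^sub>4\<close> in the last two; three vertices of \<open>C\<^sub>4\<close> always contain one. Being a disjoint
  union of products, this form can be counted.
\<close>

definition acyclic_triple_parts :: "nat \<Rightarrow> (nat set \<times> nat set) set" where
  "acyclic_triple_parts m =
     insert 0 ` {L. L \<subseteq> {1..<m} \<and> card L = 2} \<times> {{}} \<union>
     edges (star_graph m) \<times> {Y. Y \<subseteq> {..<4} \<and> card Y = 1} \<union>
     {X. X \<subseteq> {..<m} \<and> card X = 1} \<times> edges (cycle_graph 4) \<union>
     {{}} \<times> {Y. Y \<subseteq> {..<4} \<and> card Y = 3}"

lemma acyclic_triple_parts_iff:
  assumes X: "X \<subseteq> {..<m}" and Y: "Y \<subseteq> {..<4}"
  shows "(X, Y) \<in> acyclic_triple_parts m \<longleftrightarrow> card X + card Y = 3 \<and>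
     ((\<exists>e\<in>edges (star_graph m). e \<subseteq> X) \<or> (\<exists>e\<in>edges (cycle_graph 4). e \<subseteq> Y))"
    (is "_ \<longleftrightarrow> _ \<and> ((\<exists>e\<in>?E. _) \<or> (\<exists>e\<in>?F. _))")
proof -
  have fin: "finite X" "finite Y" using X Y finite_subset by auto
  have E2: "card e = 2" if "e \<in> ?E" for e using that by (auto simp: edges_star_graph)
  have F2: "card e = 2" if "e \<in> ?F" for e using that by (auto simp: edges_cycle_graph_4)
  have E_iff: "X \<in> ?E \<longleftrightarrow> card X = 2 \<and> (\<exists>e\<in>?E. e \<subseteq> X)"
    using E2 fin by (metis card_subset_eq subset_refl)
  have F_iff: "Y \<in> ?F \<longleftrightarrow> card Y = 2 \<and> (\<exists>e\<in>?F. e \<subseteq> Y)"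
    using F2 fin by (metis card_subset_eq subset_refl)
  have leaves_iff: "X \<in> insert 0 ` {L. L \<subseteq> {1..<m} \<and> card L = 2} \<longleftrightarrow>
      card X = 3 \<and> (\<exists>e\<in>?E. e \<subseteq> X)"
  proof
    assume "X \<in> insert 0 ` {L. L \<subseteq> {1..<m} \<and> card L = 2}"
    then obtain L where L: "X = insert 0 L" "L \<subseteq> {1..<m}" "card L = 2" by auto
    then have "0 \<notin> L" by auto
    then have "card X = 3" using L fin by simp
    moreover obtain i where "i \<in> L" using L by fastforce
    ultimately show "card X = 3 \<and> (\<exists>e\<in>?E. e \<subseteq> X)" using L by (auto simp: edges_star_graph)
  next
    assume r: "card X = 3 \<and> (\<exists>e\<in>?E. e \<subseteq> X)"
    then have "0 \<in> X" by (auto simp: edges_star_graph)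
    then have "X = insert 0 (X - {0})" "X - {0} \<subseteq> {1..<m}" "card (X - {0}) = 2"
      using r X fin by (auto simp: card_Diff_singleton)
    then show "X \<in> insert 0 ` {L. L \<subseteq> {1..<m} \<and> card L = 2}" by blast
  qed
  have Y3: "\<exists>e\<in>?F. e \<subseteq> Y" if "card Y = 3"
  proof -
    have "card ({..<4} - Y) = 1" using Y fin that by (subst card_Diff_subset) auto
    then obtain a where a: "{..<4} - Y = {a}" by (auto simp: card_1_singleton_iff)
    then have Y: "Y = {..<4} - {a}" using Y by blast
    show ?thesis
    proof (cases "a \<in> {0, 1}")
      case True
      then have "{2, 3} \<subseteq> Y" using Y by auto
      then show ?thesis unfolding edges_cycle_graph_4 by blast
    next
      case False
      then have "{0, 1} \<subseteq> Y" using Y by auto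
      then show ?thesis unfolding edges_cycle_graph_4 by blast
    qed
  qed
  have leE: "card X \<ge> 2" if "\<exists>e\<in>?E. e \<subseteq> X" using that E2 fin by (metis card_mono)
  have leF: "card Y \<ge> 2" if "\<exists>e\<in>?F. e \<subseteq> Y" using that F2 fin by (metis card_mono)
  have "(X, Y) \<in> acyclic_triple_parts m \<longleftrightarrow>
     (card X = 3 \<and> (\<exists>e\<in>?E. e \<subseteq> X)) \<and> card Y = 0 \<or>
     (card X = 2 \<and> (\<exists>e\<in>?E. e \<subseteq> X)) \<and> card Y = 1 \<or>
     card X = 1 \<and> (card Y = 2 \<and> (\<exists>e\<in>?F. e \<subseteq> Y)) \<or>
     card X = 0 \<and> card Y = 3"
    unfolding acyclic_triple_parts_def Un_iff mem_Times_iff fst_conv snd_conv leaves_iff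
      E_iff F_iff using X Y fin by auto
  \<comment> \<open>An edge inside \<open>X\<close> or \<open>Y\<close> forces two vertices there; the rest is propositional.\<close>
  also have "\<dots> \<longleftrightarrow> card X + card Y = 3 \<and> ((\<exists>e\<in>?E. e \<subseteq> X) \<or> (\<exists>e\<in>?F. e \<subseteq> Y))"
  proof -
    have "(x = 3 \<and> p) \<and> y = 0 \<or> (x = 2 \<and> p) \<and> y = 1 \<or>
        x = 1 \<and> (y = 2 \<and> q) \<or> x = 0 \<and> y = 3 \<longleftrightarrow>
        x + y = 3 \<and> (p \<or> q)"
      if "p \<Longrightarrow> x \<ge> 2" "q \<Longrightarrow> y \<ge> 2" "y = 3 \<Longrightarrow> q" for p q and x y :: nat
      using that by (cases p; cases q; simp; presburger)
    from this[OF leE leF Y3] show ?thesis .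
  qed
  finally show ?thesis .
qed

lemma card_acyclic_triple_parts:
  assumes "m \<ge> 1"
  shows "card (acyclic_triple_parts m) = ((m - 1) choose 2) + 4 * (m - 1) + 4 * m + 4"
proof -
  let ?A = "insert 0 ` {L. L \<subseteq> {1..<m} \<and> card L = 2} \<times> {{}} :: (nat set \<times> nat set) set"
  let ?B = "edges (star_graph m) \<times> {Y. Y \<subseteq> {..<4::nat} \<and> card Y = 1}"
  let ?C = "{X. X \<subseteq> {..<m} \<and> card X = 1} \<times> edges (cycle_graph 4)"
  let ?D = "{{}} \<times> {Y. Y \<subseteq> {..<4} \<and> card Y = 3} :: (nat set \<times> nat set) set"
  have "inj_on (insert 0) {L. L \<subseteq> {1..<m} \<and> card L = 2}"
    by (rule inj_on_inverseI[where g = "\<lambda>X. X - {0}"]) auto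
  then have A: "card ?A = (m - 1) choose 2"
    using n_subsets[of "{1..<m}" 2] by (simp add: card_cartesian_product card_image)
  have "inj_on (\<lambda>i::nat. {0, i}) {1..<m}"
    by (rule inj_onI) (auto simp: doubleton_eq_iff)
  then have B: "card ?B = 4 * (m - 1)"
    using n_subsets[of "{..<4::nat}" 1]
    by (simp add: card_cartesian_product edges_star_graph card_image)
  have "card (edges (cycle_graph 4)) = 4"
    by (auto simp: edges_cycle_graph_4 card_insert_if doubleton_eq_iff)
  then have C: "card ?C = 4 * m"
    using n_subsets[of "{..<m}" 1] by (simp add: card_cartesian_product)
  have D: "card ?D = 4"
    using n_subsets[of "{..<4::nat}" 3] by (simp add: card_cartesian_product numeral_eq_Suc)
  have sub: "finite {Z. Z \<subseteq> {a..<b} \<and> card Z = c}" "finite {Z. Z \<subseteq> {..<b} \<and> card Z = c}"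
    for a b c :: nat by simp_all
  have fin: "finite ?A" "finite ?B" "finite ?C" "finite ?D"
    by (intro finite_cartesian_product finite_imageI sub; simp add: edges_star_graph edges_cycle_graph_4)+
  have "\<And>e. e \<in> edges (cycle_graph 4) \<Longrightarrow> card e = 2" by (auto simp: edges_cycle_graph_4)
  then have disj: "?A \<inter> ?B = {}" "(?A \<union> ?B) \<inter> ?C = {}" "(?A \<union> ?B \<union> ?C) \<inter> ?D = {}"
    by (fastforce simp: edges_star_graph)+
  show ?thesis unfolding acyclic_triple_parts_def
    using fin disj by (simp only: card_Un_disjoint finite_Un A B C D simp_thms)
qed

lemma acyclic_count_J_graph_3:
  assumes "n \<ge> 5"
  shows "acyclic_count (J_graph n) 3 = ((n - 5) choose 2) + 4 * (n - 5) + 4 * (n - 4) + 4"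
proof -
  let ?H = "disjoint_union (star_graph (n - 4)) (cycle_graph 4)"
  have H: "simple_graph ?H"
    by (intro simple_graph_disjoint_union simple_graph_star_graph simple_graph_cycle_graph) simp
  have vH: "verts ?H = {..<n - 4} <+> {..<4}"
    by (simp add: disjoint_union_def star_graph_def cycle_graph_def)
  have sub: "Inl ` e \<subseteq> X <+> Y \<longleftrightarrow> e \<subseteq> X" "Inr ` e' \<subseteq> X <+> Y \<longleftrightarrow> e' \<subseteq> Y"
    for e X e' Y :: "nat set" by auto
  have parts: "X \<subseteq> {..<n - 4} \<and> Y \<subseteq> {..<4}" if "(X, Y) \<in> acyclic_triple_parts (n - 4)" for X Y
    using that assms by (auto simp: acyclic_triple_parts_def edges_star_graph edges_cycle_graph_4)
  have key: "X <+> Y \<subseteq> verts ?H \<and> card (X <+> Y) = 3 \<and>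
      acyclic_graph (induced_subgraph (complement ?H) (X <+> Y)) \<longleftrightarrow>
      (X, Y) \<in> acyclic_triple_parts (n - 4)" for X Y
  proof (cases "X \<subseteq> {..<n - 4} \<and> Y \<subseteq> {..<4}")
    case True
    then have v: "X <+> Y \<subseteq> verts ?H" and f: "finite X" "finite Y"
      by (auto simp: vH intro: finite_subset)
    have e: "(\<exists>e\<in>edges ?H. e \<subseteq> X <+> Y) \<longleftrightarrow>
        (\<exists>e\<in>edges (star_graph (n - 4)). e \<subseteq> X) \<or> (\<exists>e\<in>edges (cycle_graph 4). e \<subseteq> Y)"
      by (simp add: disjoint_union_def bex_Un sub)
    show ?thesis
      using acyclic_complement_triple_iff[OF H v] acyclic_triple_parts_iff[of X "n - 4" Y]
        True v f e by (auto simp: card_Plus)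
  next
    case False
    then have "\<not> X <+> Y \<subseteq> verts ?H" unfolding vH by blast
    then show ?thesis using False parts by blast
  qed
  have inj: "inj_on (\<lambda>(X, Y). X <+> Y) P" for P :: "(nat set \<times> nat set) set"
    by (rule inj_onI) (auto simp: Plus_def set_eq_iff image_iff)
  have "{S. S \<subseteq> verts (J_graph n) \<and> card S = 3 \<and> acyclic_graph (induced_subgraph (J_graph n) S)}
      = {S. S \<subseteq> verts ?H \<and> card S = 3 \<and> acyclic_graph (induced_subgraph (complement ?H) S)}"
    by (simp add: J_graph_def complement_def)
  also have "\<dots> = (\<lambda>(X, Y). X <+> Y) ` acyclic_triple_parts (n - 4)"
  proof (intro equalityI subsetI)
    fix S assume S: "S \<in> {S. S \<subseteq> verts ?H \<and> card S = 3 \<and>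
      acyclic_graph (induced_subgraph (complement ?H) S)}"
    obtain X Y where XY: "S = X <+> Y" using sum_set_eq_Plus by blast
    then have "(X, Y) \<in> acyclic_triple_parts (n - 4)" using S key by blast
    then show "S \<in> (\<lambda>(X, Y). X <+> Y) ` acyclic_triple_parts (n - 4)" using XY by force
  qed (use key in auto)
  finally show ?thesis
    using card_acyclic_triple_parts[of "n - 4"] assms
    by (simp add: acyclic_count_def card_image[OF inj])
qed

section \<open>The polynomial and its roots\<close>

lemma real_choose_two: "real (k choose 2) = real k * (real k - 1) / 2"
  by (induction k) (auto simp: numeral_2_eq_2 field_simps)

lemma acyclic_poly_J_graph:
  assumes "n \<ge> 5"
  shows "acyclic_poly (J_graph n) =
    [:1, real n, real n * (real n - 1) / 2, real n ^ 2 / 2 + 5 * real n / 2 - 17, 1:]"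
proof (rule poly_eqI)
  fix i :: nat
  have fin: "finite (verts (J_graph n))" by (simp add: verts_J_graph)
  have low: "acyclic_count (J_graph n) j = n choose j" if "j \<le> 2" for j
    using acyclic_count_le_2[OF fin that] order_J_graph[OF assms] by simp
  have three: "real (acyclic_count (J_graph n) 3) = real n ^ 2 / 2 + 5 * real n / 2 - 17"
    using assms by (simp add: acyclic_count_J_graph_3 real_choose_two of_nat_diff
        power2_eq_square field_simps)
  have two: "real (acyclic_count (J_graph n) 2) = real n * (real n - 1) / 2"
    by (simp add: low real_choose_two)
  have coeffs: "coeff [:a, b, c, d, e:] 0 = a" "coeff [:a, b, c, d, e:] 1 = b"
    "coeff [:a, b, c, d, e:] 2 = c" "coeff [:a, b, c, d, e:] 3 = d" "coeff [:a, b, c, d, e:] 4 = e"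
    for a b c d e :: real
    by (simp_all add: coeff_pCons numeral_eq_Suc)
  consider "i = 0" | "i = 1" | "i = 2" | "i = 3" | "i = 4" | "i \<ge> 5" by linarith
  then show "coeff (acyclic_poly (J_graph n)) i =
    coeff [:1, real n, real n * (real n - 1) / 2, real n ^ 2 / 2 + 5 * real n / 2 - 17, 1:] i"
  proof cases
    case 6
    then show ?thesis
      by (simp add: coeff_acyclic_poly[OF fin] acyclic_count_J_graph_ge_5 coeff_pCons
          split: nat.split)
  qed (simp_all only: coeff_acyclic_poly[OF fin] coeffs two three,
      simp_all add: low acyclic_count_J_graph_4)
qed

text \<open>
  The Enestroem-Kakeya bound for a monic quartic. Multiplying the polynomial \<open>P\<close> by \<open>a - x\<close>
  cancels the coefficient of \<open>x\<^sup>4\<close> and turns the others, except for the leading \<open>-1\<close>, into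
  nonnegative numbers: this is what the upper bounds on \<open>1\<close>, \<open>b\<close> and \<open>c\<close> express. At a root \<open>z\<close> of modulus \<open>r\<close>
  the triangle inequality then gives \<open>r\<^sup>5 \<le> r\<^sup>5 + (a - r) P(r)\<close>, which is impossible for \<open>r > a\<close>
  because \<open>P\<close> is positive on the positive reals.
\<close>

lemma quartic_root_bound:
  fixes a b c :: real and z :: complex
  assumes "0 \<le> c" "c \<le> a * b" "b \<le> a * a" "1 \<le> a * c" "0 \<le> b" "0 \<le> a"
    and root: "1 + c * z + b * z ^ 2 + a * z ^ 3 + z ^ 4 = 0"
  shows "cmod z \<le> a"
proof (rule ccontr)
  assume "\<not> cmod z \<le> a"
  define r where "r = cmod z"
  have r: "r > a" using \<open>\<not> cmod z \<le> a\<close> by (simp add: r_def)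
  have "(of_real a - z) * (1 + c * z + b * z ^ 2 + a * z ^ 3 + z ^ 4) =
      of_real a + of_real (a * c - 1) * z + of_real (a * b - c) * z ^ 2 +
      of_real (a * a - b) * z ^ 3 - z ^ 5"
    by (simp add: algebra_simps power_numeral_reduce)
  then have "z ^ 5 = of_real a + of_real (a * c - 1) * z + of_real (a * b - c) * z ^ 2 +
      of_real (a * a - b) * z ^ 3"
    unfolding root by simp
  then have "r ^ 5 = cmod (of_real a + of_real (a * c - 1) * z + of_real (a * b - c) * z ^ 2 +
      of_real (a * a - b) * z ^ 3)"
    by (simp add: r_def flip: norm_power)
  also have "\<dots> \<le> cmod (of_real a) + cmod (of_real (a * c - 1) * z) +
      cmod (of_real (a * b - c) * z ^ 2) + cmod (of_real (a * a - b) * z ^ 3)"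
    by (intro order.trans[OF norm_triangle_ineq] add_right_mono order.refl)
  also have "\<dots> = a + (a * c - 1) * r + (a * b - c) * r ^ 2 + (a * a - b) * r ^ 3"
    unfolding norm_mult norm_power norm_of_real r_def using assms by simp
  also have "\<dots> = r ^ 5 - (r - a) * (1 + c * r + b * r ^ 2 + a * r ^ 3 + r ^ 4)"
    by (simp add: algebra_simps power_numeral_reduce)
  finally have "(r - a) * (1 + c * r + b * r ^ 2 + a * r ^ 3 + r ^ 4) \<le> 0" by simp
  moreover have "1 + c * r + b * r ^ 2 + a * r ^ 3 + r ^ 4 > 0"
    using assms r by (intro add_pos_nonneg) auto
  ultimately show False using r by (simp add: mult_le_0_iff)
qed

theorem theorem2p19:
  fixes n :: nat
  assumes "n \<ge> 6"
  shows "(\<exists>r::real. poly (acyclic_poly (J_graph n)) r = 0 \<and>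
            - (real n ^ 2 / 2) - 5 * real n / 2 + 17 \<le> r \<and>
            r \<le> - (real n ^ 2 / 2) - 5 * real n / 2 + 18) \<and>
         \<not> (\<exists>z::complex. poly (map_poly complex_of_real (acyclic_poly (J_graph n))) z = 0 \<and>
            cmod z > real n ^ 2 / 2 + 5 * real n / 2 - 17)"
proof -
  define a where "a = real n ^ 2 / 2 + 5 * real n / 2 - 17"
  define b where "b = real n * (real n - 1) / 2"
  let ?p = "[:1, real n, b, a, 1:]"
  have p: "acyclic_poly (J_graph n) = ?p"
    using assms by (simp add: acyclic_poly_J_graph a_def b_def)
  have n: "real n \<ge> 6" using assms by simp
  \<comment> \<open>The hypothesis \<open>n \<ge> 6\<close> makes the bracket at least 1.\<close>
  have ab: "a = b + (3 * real n - 17)"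
    by (simp add: a_def b_def power2_eq_square field_simps)
  have nb: "real n \<le> b"
    using mult_left_mono[of 2 "real n - 1" "real n"] n by (simp add: b_def)
  have ba: "b + 1 \<le> a" using n ab by simp
  have "\<exists>r\<ge>-a. r \<le> 1 - a \<and> poly ?p r = 0"
  proof -
    have "poly ?p (-a) = 1 + a * (a * b - real n)"
      by (simp add: algebra_simps)
    moreover have "a * b - real n \<ge> 0"
      using mult_mono[of 1 a "real n" b] n nb ba by simp
    ultimately have lo: "poly ?p (-a) \<ge> 0" using n nb ba by simp
    have "poly ?p (1 - a) = (a - 1)^2 * (b + 1 - a) + (1 - real n * (a - 1))"
      by (simp add: algebra_simps power2_eq_square)
    moreover have "(a - 1)^2 * (b + 1 - a) \<le> 0"
      using ba by (intro mult_nonneg_nonpos) auto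
    moreover have "real n * (a - 1) \<ge> 1"
      using mult_mono[of 1 "real n" 1 "a - 1"] n nb ba by simp
    ultimately have hi: "poly ?p (1 - a) \<le> 0" by linarith
    have "continuous_on {-a..1 - a} (poly ?p)" by (intro continuous_intros)
    then show ?thesis using IVT2'[of "poly ?p", OF hi lo] by simp
  qed
  then obtain r where r: "poly ?p r = 0" "-a \<le> r" "r \<le> 1 - a" by blast
  have "cmod z \<le> a" if z: "poly (map_poly complex_of_real ?p) z = 0" for z
  proof (rule quartic_root_bound)
    show "real n \<le> a * b" using mult_mono[of 1 a "real n" b] n nb ba by simp
    show "b \<le> a * a" using mult_mono[of 1 a b a] n nb ba by simp
    show "1 \<le> a * real n" using mult_mono[of 1 a 1 "real n"] n nb ba by simp
    show "1 + real n * z + b * z ^ 2 + a * z ^ 3 + z ^ 4 = 0"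
      using z by (simp add: map_poly_pCons algebra_simps power_numeral_reduce)
  qed (use n nb ba in auto)
  then show ?thesis unfolding p a_def[symmetric]
    using r by (auto simp: a_def not_less intro!: exI[of _ r])
qed

end
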